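(* Let $\Omega\subsetneq\mathbb{C}$ be a simply connected domain containing $\mathbb{D}$, let $\mathcal{H}$ be a complex Hilbert space, and fix $p\in[1,2]$. Let $f\in H^\infty(\Omega,\mathcal{B}(\mathcal{H}))$ be given by $f(z)=\sum_{n=0}^\infty A_nz^n$ in $\mathbb{D}$ with $\|f\|_{H^\infty(\Omega,\mathcal{B}(\mathcal{H}))}\le1$, where $A_0=\alpha_0I$ with $|\alpha_0|<1$ and $A_n\in\mathcal{B}(\mathcal{H})$ for all $n\ge 0$. If $\phi=\{\phi_n(r)\}_{n=0}^\infty\in\mathcal{G}$ satisfies $$p\,\phi_0(r)>2\lambda_{\mathcal{H}}\sum_{n=1}^\infty\phi_n(r)\quad\text{for } r\in[0,R_\Omega(p)),$$ where $R_\Omega(p)$ is the smallest root in $(0,1)$ of the equation $p\,\phi_0(r)=2\lambda_{\mathcal{H}}\sum_{n=1}^\infty\phi_n(r)$, then $$\|A_0\|^p\phi_0(r)+\sum_{n=1}^\infty\|A_n\|\phi_n(r)\le\phi_0(r)$$ holds for $|z|=r\le R_\Omega(p)$. That is (when $\phi_0\le 1$, so that $R_{p,1,\phi}$ is defined), $R_\Omega(p)\le R_{p,1,\phi}(\Omega,\mathcal{B}(\mathcal{H}))$.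
   Context: $\mathbb{D}=\{z\in\mathbb{C}:|z|<1\}$. $\mathcal{B}(\mathcal{H})$ is the space of bounded linear operators on $\mathcal{H}$ with the operator norm, $I$ is the identity operator, and $|T|=(T^*T)^{1/2}$. $H^\infty(\Omega,X)$ is the space of bounded analytic functions from $\Omega$ into a complex Banach space $X$, with $\|f\|_{H^\infty(\Omega,X)}=\sup_{z\in\Omega}\|f(z)\|$. $\mathcal{G}$ is the set of all sequences $\phi=\{\phi_n(r)\}_{n=0}^{\infty}$ of non-negative continuous functions on $[0,1)$ such that $\sum_{n=0}^{\infty}\phi_n(r)$ converges locally uniformly with respect to $r\in[0,1)$. $$\lambda_{\mathcal{H}}=\lambda_{\mathcal{H}}(\Omega)=\sup\left\{\frac{\|A_n\|}{\|I-|A_0|^2\|}\right\},$$ the supremum being over all $n\ge1$ and all non-constant $f\in H^\infty(\Omega,\mathcal{B}(\mathcal{H}))$ with $\|f(z)\|\le1$ on $\Omega$, where $f(z)=\sum_{n=0}^\infty A_nz^n$ in $\mathbb{D}$. For $f\in H^\infty(\Omega,X)$ with $f(z)=\sum_{n=0}^\infty x_nz^n$ in $\mathbb{D}$ and $\|f\|_{H^\infty(\Omega,X)}\le1$, for $\phi\in\mathcal{G}$ with $\phi_0(r)\le1$, and for $1\le p,q<\infty$, $$R_{p,q,\phi}(f,\Omega,X)=\sup\Big\{r\in[0,1):\ \|x_0\|^p\phi_0(r)+\Big(\sum_{n=1}^\infty\|x_n\|\phi_n(r)\Big)^q\le\phi_0(r)\Big\},$$ and $R_{p,q,\phi}(\Omega,X)=\inf\{R_{p,q,\phi}(f,\Omega,X):\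 \|f\|_{H^\infty(\Omega,X)}\le1\}$.
   Formalization: In the last sentence the infimum defining R_{p,1,φ}(Ω,B(H)) is taken only over f in the unit ball with A_0=α_0 I, |α_0|<1; over the whole unit ball the claim fails, e.g. f(z)=diag(1,z), Ω=D, H=C², p=1, φ_n=r^n. *)

theory Defs
  imports "HOL-Analysis.Analysis"
begin

section \<open>Complex Banach and Hilbert spaces\<close>

class complex_normed_vector = real_normed_vector +
  fixes scaleC :: "complex \<Rightarrow> 'a \<Rightarrow> 'a"  (infixr "*\<^sub>C" 75)
  assumes scaleC_add_right: "a *\<^sub>C (x + y) = a *\<^sub>C x + a *\<^sub>C y"
    and scaleC_add_left: "(a + b) *\<^sub>C x = a *\<^sub>C x + b *\<^sub>C x"
    and scaleC_scaleC: "a *\<^sub>C (b *\<^sub>C x) = (a * b) *\<^sub>C x"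
    and scaleC_of_real: "complex_of_real r *\<^sub>C x = r *\<^sub>R x"
    and norm_scaleC: "norm (a *\<^sub>C x) = cmod a * norm x"

class cbanach = complex_normed_vector + complete_space

text \<open>The inner product is linear in the second argument. Definiteness and positivity are
  contained in the last axiom, as the norm is already known to be a norm.\<close>

class chilbert = cbanach +
  fixes cinner :: "'a \<Rightarrow> 'a \<Rightarrow> complex"
  assumes cinner_add_right: "cinner x (y + z) = cinner x y + cinner x z"
    and cinner_scaleC_right: "cinner x (a *\<^sub>C y) = a * cinner x y"
    and cinner_commute: "cinner y x = cnj (cinner x y)"
    and cinner_self: "cinner x x = complex_of_real ((norm x)\<^sup>2)"

instantiation complex :: chilbert
begin
definition scaleC_complex :: "complex \<Rightarrow> complex \<Rightarrow> complex" where "scaleC_complex a x = a * x"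
definition cinner_complex :: "complex \<Rightarrow> complex \<Rightarrow> complex" where "cinner_complex x y = cnj x * y"
instance
  by standard
    (simp_all add: scaleC_complex_def cinner_complex_def distrib_left distrib_right norm_mult
      scaleR_conv_of_real complex_norm_square mult.commute mult.left_commute flip: of_real_power)
end


section \<open>Bounded linear operators between complex spaces\<close>

typedef (overloaded) ('a, 'b) cblinfun  ("(_ \<Rightarrow>\<^sub>C\<^sub>L /_)" [22, 21] 21) =
  "{f :: 'a::complex_normed_vector \<Rightarrow> 'b::complex_normed_vector.
      bounded_linear f \<and> (\<forall>c x. f (c *\<^sub>C x) = c *\<^sub>C f x)}"
  morphisms cblinfun_apply Cblinfun
proof (rule exI[of _ "\<lambda>x. 0"])
  have "c *\<^sub>C (0::'b) = 0" for c
    by (metis mult_zero_right norm_eq_zero norm_scaleC)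
  then show "(\<lambda>x::'a. 0::'b) \<in> {f. bounded_linear f \<and> (\<forall>c x. f (c *\<^sub>C x) = c *\<^sub>C f x)}"
    by simp
qed

setup_lifting type_definition_cblinfun

lemma scaleC_zero_right [simp]: "c *\<^sub>C (0::'a::complex_normed_vector) = 0"
  by (metis mult_zero_right norm_eq_zero norm_scaleC)

lemma scaleC_minus_right: "c *\<^sub>C (- x) = - (c *\<^sub>C (x::'a::complex_normed_vector))"
  by (metis add.right_inverse minus_unique scaleC_add_right scaleC_zero_right)

lemma scaleC_diff_right: "c *\<^sub>C (x - y) = c *\<^sub>C x - c *\<^sub>C (y::'a::complex_normed_vector)"
  using scaleC_add_right[of c x "- y"] by (simp add: scaleC_minus_right)

lemma scaleC_scaleR_commute:
  "c *\<^sub>C (r *\<^sub>R x) = r *\<^sub>R (c *\<^sub>C (x::'a::complex_normed_vector))"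
  by (metis mult.commute scaleC_of_real scaleC_scaleC)

lemma bounded_linear_scaleC: "bounded_linear (\<lambda>x::'a::complex_normed_vector. c *\<^sub>C x)"
  by (rule bounded_linear_intro[of _ "cmod c"])
    (simp_all add: scaleC_add_right scaleC_scaleR_commute norm_scaleC mult.commute)

lemma onorm_scaleC:
  fixes f :: "'a::real_normed_vector \<Rightarrow> 'b::complex_normed_vector"
  assumes f: "bounded_linear f"
  shows "onorm (\<lambda>x. c *\<^sub>C f x) = cmod c * onorm f"
proof (rule antisym)
  have bl: "bounded_linear (\<lambda>x. c *\<^sub>C f x)"
    by (rule bounded_linear_compose[OF bounded_linear_scaleC f])
  show "onorm (\<lambda>x. c *\<^sub>C f x) \<le> cmod c * onorm f"
  proof (rule onorm_bound)
    show "0 \<le> cmod c * onorm f"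
      by (simp add: f onorm_pos_le)
    show "norm (c *\<^sub>C f x) \<le> cmod c * onorm f * norm x" for x
      by (simp add: norm_scaleC mult.assoc mult_left_mono onorm[OF f])
  qed
  show "cmod c * onorm f \<le> onorm (\<lambda>x. c *\<^sub>C f x)"
  proof (cases "c = 0")
    case True
    then show ?thesis using onorm_pos_le[OF bl] by simp
  next
    case False
    have "onorm f \<le> onorm (\<lambda>x. c *\<^sub>C f x) / cmod c"
    proof (rule onorm_bound)
      show "0 \<le> onorm (\<lambda>x. c *\<^sub>C f x) / cmod c"
        by (simp add: onorm_pos_le[OF bl])
      show "norm (f x) \<le> onorm (\<lambda>x. c *\<^sub>C f x) / cmod c * norm x" for x
        using onorm[OF bl, of x] False by (simp add: norm_scaleC field_simps)
    qed
    then show ?thesis using False by (simp add: field_simps)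
  qed
qed

instantiation cblinfun :: (complex_normed_vector, complex_normed_vector) complex_normed_vector
begin

lift_definition norm_cblinfun :: "'a \<Rightarrow>\<^sub>C\<^sub>L 'b \<Rightarrow> real" is onorm .

lift_definition minus_cblinfun :: "'a \<Rightarrow>\<^sub>C\<^sub>L 'b \<Rightarrow> 'a \<Rightarrow>\<^sub>C\<^sub>L 'b \<Rightarrow> 'a \<Rightarrow>\<^sub>C\<^sub>L 'b" is "\<lambda>f g x. f x - g x"
  by (simp add: bounded_linear_sub scaleC_diff_right)

definition dist_cblinfun :: "'a \<Rightarrow>\<^sub>C\<^sub>L 'b \<Rightarrow> 'a \<Rightarrow>\<^sub>C\<^sub>L 'b \<Rightarrow> real"
  where "dist_cblinfun a b = norm (a - b)"

definition uniformity_cblinfun :: "(('a \<Rightarrow>\<^sub>C\<^sub>L 'b) \<times> ('a \<Rightarrow>\<^sub>C\<^sub>L 'b)) filter"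
  where "uniformity_cblinfun = (INF e\<in>{0 <..}. principal {(x, y). dist x y < e})"

definition open_cblinfun :: "('a \<Rightarrow>\<^sub>C\<^sub>L 'b) set \<Rightarrow> bool"
  where "open_cblinfun S = (\<forall>x\<in>S. \<forall>\<^sub>F (x', y) in uniformity. x' = x \<longrightarrow> y \<in> S)"

lift_definition uminus_cblinfun :: "'a \<Rightarrow>\<^sub>C\<^sub>L 'b \<Rightarrow> 'a \<Rightarrow>\<^sub>C\<^sub>L 'b" is "\<lambda>f x. - f x"
  by (simp add: bounded_linear_minus scaleC_minus_right)

lift_definition zero_cblinfun :: "'a \<Rightarrow>\<^sub>C\<^sub>L 'b" is "\<lambda>x. 0"
  by simp

lift_definition plus_cblinfun :: "'a \<Rightarrow>\<^sub>C\<^sub>L 'b \<Rightarrow> 'a \<Rightarrow>\<^sub>C\<^sub>L 'b \<Rightarrow> 'a \<Rightarrow>\<^sub>C\<^sub>L 'b" is "\<lambda>f g x. f x + g x"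
  by (simp add: bounded_linear_add scaleC_add_right)

lift_definition scaleR_cblinfun :: "real \<Rightarrow> 'a \<Rightarrow>\<^sub>C\<^sub>L 'b \<Rightarrow> 'a \<Rightarrow>\<^sub>C\<^sub>L 'b" is "\<lambda>r f x. r *\<^sub>R f x"
  by (simp add: bounded_linear_compose[OF bounded_linear_scaleR_right] scaleC_scaleR_commute)

lift_definition scaleC_cblinfun :: "complex \<Rightarrow> 'a \<Rightarrow>\<^sub>C\<^sub>L 'b \<Rightarrow> 'a \<Rightarrow>\<^sub>C\<^sub>L 'b" is "\<lambda>c f x. c *\<^sub>C f x"
  by (simp add: bounded_linear_compose[OF bounded_linear_scaleC] scaleC_scaleC mult.commute)

definition sgn_cblinfun :: "'a \<Rightarrow>\<^sub>C\<^sub>L 'b \<Rightarrow> 'a \<Rightarrow>\<^sub>C\<^sub>L 'b"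
  where "sgn_cblinfun x = scaleR (inverse (norm x)) x"

instance
  by standard
    (unfold dist_cblinfun_def open_cblinfun_def sgn_cblinfun_def uniformity_cblinfun_def,
      (rule refl | (transfer, simp add: onorm_triangle onorm_scaleR onorm_scaleC onorm_eq_0 fun_eq_iff
        scaleC_add_right scaleC_add_left scaleC_scaleC scaleC_of_real algebra_simps))+)

end

lift_definition blinfun_of_cblinfun ::
  "('a::complex_normed_vector \<Rightarrow>\<^sub>C\<^sub>L 'b::complex_normed_vector) \<Rightarrow> 'a \<Rightarrow>\<^sub>L 'b" is "\<lambda>f. f"
  by simp

lemma blinfun_of_cblinfun_apply: "blinfun_apply (blinfun_of_cblinfun f) = cblinfun_apply f"
  by transfer simp

lemma dist_blinfun_of_cblinfun: "dist (blinfun_of_cblinfun f) (blinfun_of_cblinfun g) = dist f g"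
  unfolding dist_norm norm_blinfun.rep_eq norm_cblinfun.rep_eq
  by (simp add: minus_blinfun.rep_eq minus_cblinfun.rep_eq blinfun_of_cblinfun_apply)

instance cbanach \<subseteq> banach ..

instance cblinfun :: (complex_normed_vector, cbanach) cbanach
proof
  fix X :: "nat \<Rightarrow> 'a \<Rightarrow>\<^sub>C\<^sub>L 'b"
  assume "Cauchy X"
  then have "Cauchy (\<lambda>n. blinfun_of_cblinfun (X n))"
    by (simp add: Cauchy_def dist_blinfun_of_cblinfun)
  then have "convergent (\<lambda>n. blinfun_of_cblinfun (X n))"
    by (rule Cauchy_convergent)
  then obtain L where L: "(\<lambda>n. blinfun_of_cblinfun (X n)) \<longlonglongrightarrow> L"
    unfolding convergent_def ..
  have lim: "(\<lambda>n. cblinfun_apply (X n) x) \<longlonglongrightarrow> blinfun_apply L x" for x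
    using blinfun.tendsto[OF L tendsto_const[of x]] by (simp add: blinfun_of_cblinfun_apply)
  have "blinfun_apply L (c *\<^sub>C x) = c *\<^sub>C blinfun_apply L x" for c x
  proof (rule LIMSEQ_unique[OF lim])
    have "(\<lambda>n. c *\<^sub>C cblinfun_apply (X n) x) \<longlonglongrightarrow> c *\<^sub>C blinfun_apply L x"
      by (rule bounded_linear.tendsto[OF bounded_linear_scaleC lim])
    moreover have "cblinfun_apply (X n) (c *\<^sub>C x) = c *\<^sub>C cblinfun_apply (X n) x" for n
      using cblinfun_apply[of "X n"] by simp
    ultimately show "(\<lambda>n. cblinfun_apply (X n) (c *\<^sub>C x)) \<longlonglongrightarrow> c *\<^sub>C blinfun_apply L x"
      by simp
  qed
  then have "\<exists>M. blinfun_of_cblinfun M = L"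
    by (intro exI[of _ "Cblinfun (blinfun_apply L)"] blinfun_eqI)
      (simp add: blinfun_of_cblinfun_apply Cblinfun_inverse blinfun.bounded_linear_right)
  then obtain M where "blinfun_of_cblinfun M = L" ..
  with L have "X \<longlonglongrightarrow> M"
    unfolding tendsto_iff by (auto simp: dist_blinfun_of_cblinfun)
  then show "convergent X"
    by (rule convergentI)
qed

lift_definition id_cblinfun :: "'a::complex_normed_vector \<Rightarrow>\<^sub>C\<^sub>L 'a" is "\<lambda>x. x"
  by simp

lift_definition cblinfun_compose :: "('b::complex_normed_vector \<Rightarrow>\<^sub>C\<^sub>L 'c::complex_normed_vector) \<Rightarrow>
    ('a::complex_normed_vector \<Rightarrow>\<^sub>C\<^sub>L 'b) \<Rightarrow> ('a \<Rightarrow>\<^sub>C\<^sub>L 'c)"  (infixl "o\<^sub>C\<^sub>L" 67) is "\<lambda>f g x. f (g x)"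
  by (simp add: bounded_linear_compose)

text \<open>By the Riesz representation theorem there is exactly one operator as described.\<close>

definition adj :: "('a::chilbert \<Rightarrow>\<^sub>C\<^sub>L 'b::chilbert) \<Rightarrow> 'b \<Rightarrow>\<^sub>C\<^sub>L 'a" where
  "adj T = (THE S. \<forall>x y. cinner (cblinfun_apply T x) y = cinner x (cblinfun_apply S y))"

definition positive_op :: "('a::chilbert \<Rightarrow>\<^sub>C\<^sub>L 'a) \<Rightarrow> bool" where
  "positive_op T \<longleftrightarrow> (\<forall>x. cinner x (cblinfun_apply T x) \<in> \<real>\<^sub>\<ge>\<^sub>0)"

text \<open>$|T| = (T^* T)^{1/2}$; a positive operator has exactly one positive square root, so the
  choice operator makes no choice here.\<close>

definition abs_op :: "('a::chilbert \<Rightarrow>\<^sub>C\<^sub>L 'b::chilbert) \<Rightarrow> 'a \<Rightarrow>\<^sub>C\<^sub>L 'a" where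
  "abs_op T = (SOME S. positive_op S \<and> S o\<^sub>C\<^sub>L S = adj T o\<^sub>C\<^sub>L T)"


section \<open>Bounded analytic functions with values in a Banach space\<close>

definition analytic_into :: "complex set \<Rightarrow> (complex \<Rightarrow> 'x::cbanach) \<Rightarrow> bool" where
  "analytic_into \<Omega> f \<longleftrightarrow>
     (\<forall>z\<in>\<Omega>. \<exists>D. ((\<lambda>w. inverse (w - z) *\<^sub>C (f w - f z)) \<longlongrightarrow> D) (at z within \<Omega>))"

definition Hinf :: "complex set \<Rightarrow> (complex \<Rightarrow> 'x::cbanach) set" where
  "Hinf \<Omega> = {f. analytic_into \<Omega> f \<and> bounded (f ` \<Omega>)}"

definition Hinf_norm :: "complex set \<Rightarrow> (complex \<Rightarrow> 'x::cbanach) \<Rightarrow> real" where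
  "Hinf_norm \<Omega> f = (SUP z\<in>\<Omega>. norm (f z))"

definition Hinf_ball :: "complex set \<Rightarrow> (complex \<Rightarrow> 'x::cbanach) set" where
  "Hinf_ball \<Omega> = {f \<in> Hinf \<Omega>. Hinf_norm \<Omega> f \<le> 1}"

definition has_maclaurin :: "(complex \<Rightarrow> 'x::cbanach) \<Rightarrow> (nat \<Rightarrow> 'x) \<Rightarrow> bool" where
  "has_maclaurin f x \<longleftrightarrow> (\<forall>z\<in>ball 0 1. (\<lambda>n. z ^ n *\<^sub>C x n) sums f z)"

text \<open>A function has at most one such sequence of coefficients.\<close>

definition maclaurin :: "(complex \<Rightarrow> 'x::cbanach) \<Rightarrow> nat \<Rightarrow> 'x" where
  "maclaurin f = (SOME x. has_maclaurin f x)"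


section \<open>The constant $\lambda_{\mathcal H}(\Omega)$\<close>

text \<open>The supremum is taken in $[0,\infty]$: it is infinite when the quotients are unbounded, and
  0 when there is no non-constant function at all, that is, when the Hilbert space is trivial.
  For the functions considered the denominator never vanishes unless the space is trivial.\<close>

definition lambda_H :: "'h::chilbert itself \<Rightarrow> complex set \<Rightarrow> ennreal" where
  "lambda_H _ \<Omega> =
     Sup {ennreal (norm (A n) / norm (id_cblinfun - abs_op (A 0) o\<^sub>C\<^sub>L abs_op (A 0))) | n A f.
       1 \<le> n \<and> f \<in> (Hinf \<Omega> :: (complex \<Rightarrow> 'h \<Rightarrow>\<^sub>C\<^sub>L 'h) set) \<and> \<not> f constant_on \<Omega> \<and>
       (\<forall>z\<in>\<Omega>. norm (f z) \<le> 1) \<and> has_maclaurin f A}"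


section \<open>Bohr radii\<close>

definition class_G :: "(nat \<Rightarrow> real \<Rightarrow> real) set" where
  "class_G = {\<phi>.
     (\<forall>n. continuous_on {0..<1} (\<phi> n)) \<and> (\<forall>n. \<forall>r\<in>{0..<1}. 0 \<le> \<phi> n r) \<and>
     (\<forall>r\<in>{0..<1}. \<exists>e>0.
        uniformly_convergent_on ({0..<1} \<inter> ball r e) (\<lambda>N s. \<Sum>n<N. \<phi> n s))}"

text \<open>Convergence is part of the inequality, since \<^const>\<open>suminf\<close> is unspecified for divergent
  series.\<close>

definition bohr_ineq ::
    "real \<Rightarrow> real \<Rightarrow> (nat \<Rightarrow> real \<Rightarrow> real) \<Rightarrow> (nat \<Rightarrow> 'x::cbanach) \<Rightarrow> real \<Rightarrow> bool" where
  "bohr_ineq p q \<phi> x r \<longleftrightarrow>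
     summable (\<lambda>n. norm (x (Suc n)) * \<phi> (Suc n) r) \<and>
     norm (x 0) powr p * \<phi> 0 r + (\<Sum>n. norm (x (Suc n)) * \<phi> (Suc n) r) powr q \<le> \<phi> 0 r"

definition bohr_radius_fun ::
    "real \<Rightarrow> real \<Rightarrow> (nat \<Rightarrow> real \<Rightarrow> real) \<Rightarrow> (complex \<Rightarrow> 'x::cbanach) \<Rightarrow> ennreal" where
  "bohr_radius_fun p q \<phi> f = (SUP r\<in>{r\<in>{0..<1}. bohr_ineq p q \<phi> (maclaurin f) r}. ennreal r)"

text \<open>$R_{p,q,\phi}(\Omega,X)$ is the case \<^term>\<open>F = Hinf_ball \<Omega>\<close>.\<close>

definition bohr_radius ::
    "real \<Rightarrow> real \<Rightarrow> (nat \<Rightarrow> real \<Rightarrow> real) \<Rightarrow> (complex \<Rightarrow> 'x::cbanach) set \<Rightarrow> ennreal" where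
  "bohr_radius p q \<phi> F = (INF f\<in>F. bohr_radius_fun p q \<phi> f)"

text \<open>The functions in the unit ball whose constant term is $\alpha_0 I$ with $|\alpha_0| < 1$.
  For operator-valued functions the radius has to be taken over this class: as soon as the space
  has dimension at least 2, the function $f(z) = \mathrm{diag}(1, z)$ on the unit disc, which has
  $\|A_0\| = \|A_1\| = 1$, makes the radius over the whole unit ball 0 for $\phi_n(r) = r^n$.\<close>

definition scalar_unit_ball :: "complex set \<Rightarrow> (complex \<Rightarrow> 'h::chilbert \<Rightarrow>\<^sub>C\<^sub>L 'h) set" where
  "scalar_unit_ball \<Omega> = {f \<in> Hinf_ball \<Omega>.
     \<exists>A \<alpha>\<^sub>0. has_maclaurin f A \<and> A 0 = \<alpha>\<^sub>0 *\<^sub>C id_cblinfun \<and> cmod \<alpha>\<^sub>0 < 1}"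

end

theory Submission
  imports Defs
begin

text \<open>
  Two estimates meet. If \<open>f\<close> is not constant, it takes part in the supremum defining
  \<^const>\<open>lambda_H\<close>. Since \<open>A\<^sub>0 = \<alpha>\<^sub>0 I\<close>, the operator \<open>I - |A\<^sub>0|\<^sup>2\<close> is \<open>(1 - |\<alpha>\<^sub>0|\<^sup>2) I\<close>, so that
  \<open>\<parallel>A\<^sub>n\<parallel> \<le> \<lambda> (1 - |\<alpha>\<^sub>0|\<^sup>2)\<close> for \<open>n \<ge> 1\<close> (lemma \<open>norm_coeff_le_lambda_H\<close>); if \<open>f\<close> is constant, these
  coefficients vanish because Maclaurin coefficients are unique. Summing against \<open>\<phi>\<^sub>n(r)\<close> and
  using \<open>2 \<lambda> \<Sum> \<phi>\<^sub>n(r) \<le> p \<phi>\<^sub>0(r)\<close>, which holds up to and including \<open>r = R\<close>, gives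
  \<open>\<Sum> \<parallel>A\<^sub>n\<parallel> \<phi>\<^sub>n(r) \<le> (p/2) (1 - |\<alpha>\<^sub>0|\<^sup>2) \<phi>\<^sub>0(r)\<close>. The exponent enters only through the inequality
  \<open>(p/2) (1 - a\<^sup>2) \<le> 1 - a\<^sup>p\<close>, which is where \<open>p \<le> 2\<close> is used: \<open>s \<mapsto> s\<^bsup>p/2\<^esup>\<close> is then concave.

  The summation is carried out in \<^typ>\<open>ennreal\<close>. There the case \<open>\<lambda> = \<infinity>\<close> needs no separate
  treatment, and the convergence of \<open>\<Sum> \<parallel>A\<^sub>n\<parallel> \<phi>\<^sub>n(r)\<close> comes out of the finite bound.

  For the Bohr radius it is enough that the inequality holds at the single point \<open>r = R\<close>,
  for every function of the class.
\<close>

section \<open>Uniqueness of Maclaurin coefficients\<close>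

text \<open>At real points \<open>t\<close> of the disc, \<^const>\<open>scaleC\<close> is real scaling. The first coefficient that
  could differ from \<open>0\<close> is \<open>O(t)\<close> as \<open>t\<close> tends to \<open>0\<close>, since the coefficients grow at most
  geometrically.\<close>

lemma power_series_zero_imp_coeffs_zero:
  fixes x :: "nat \<Rightarrow> 'x::banach"
  assumes "\<And>t. 0 < t \<Longrightarrow> t < 1 \<Longrightarrow> (\<lambda>n. t ^ n *\<^sub>R x n) sums 0"
  shows "x k = 0"
proof (induction k rule: less_induct)
  case (less k)
  have "(\<lambda>n. (1/2) ^ n *\<^sub>R x n) \<longlonglongrightarrow> 0"
    using assms[of "1/2"] by (intro summable_LIMSEQ_zero sums_summable) auto
  then have "Bseq (\<lambda>n. (1/2) ^ n *\<^sub>R x n)"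
    by (intro convergent_imp_Bseq convergentI)
  then obtain M where M: "norm ((1/2) ^ n *\<^sub>R x n) \<le> M" and "M > 0" for n
    unfolding Bseq_def by blast
  \<comment> \<open>Convergence at \<open>1/2\<close> gives growth rate \<open>2\<close>. For \<open>t < 1/4\<close> the terms after the \<open>k\<close>-th are then
     dominated by a geometric series of ratio \<open>1/2\<close>.\<close>
  have growth: "norm (x n) \<le> M * 2 ^ n" for n
    using M[of n] by (simp add: power_one_over field_simps)
  have small: "norm (x k) \<le> t * (M * 2 ^ (k + 2))" if t: "0 < t" "t < 1/4" for t :: real
  proof -
    let ?c = "t * (M * 2 ^ (k + 1))"
    have "(\<lambda>n. t ^ (n + k) *\<^sub>R x (n + k)) sums (0 - (\<Sum>n<k. t ^ n *\<^sub>R x n))"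
      using assms[of t] t by (subst sums_iff_shift') auto
    then have "(\<lambda>n. t ^ (n + k) *\<^sub>R x (n + k)) sums 0"
      using less.IH by simp
    then have "(\<lambda>n. (1 / t ^ k) *\<^sub>R (t ^ (n + k) *\<^sub>R x (n + k))) sums ((1 / t ^ k) *\<^sub>R 0)"
      by (rule sums_scaleR_right)
    then have "(\<lambda>n. t ^ n *\<^sub>R x (n + k)) sums 0"
      using t by (simp add: power_add)
    then have tail: "(\<lambda>n. t ^ Suc n *\<^sub>R x (Suc n + k)) sums (- x k)"
      by (subst sums_Suc_iff) simp
    have geo: "(\<lambda>n. ?c * (1/2) ^ n) sums (?c * 2)"
      using geometric_sums[of "1/2::real"] by (intro sums_mult) simp
    have "norm (t ^ Suc n *\<^sub>R x (Suc n + k)) \<le> ?c * (1/2) ^ n" for n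
    proof -
      have "norm (t ^ Suc n *\<^sub>R x (Suc n + k)) \<le> t ^ Suc n * (M * 2 ^ (Suc n + k))"
        using growth[of "Suc n + k"] t by (simp add: mult_left_mono del: power_Suc)
      also have "\<dots> = ?c * (2 * t) ^ n"
        by (simp add: power_add power_mult_distrib)
      also have "\<dots> \<le> ?c * (1/2) ^ n"
        using t \<open>M > 0\<close> by (intro mult_left_mono power_mono) auto
      finally show ?thesis .
    qed
    then have "norm (- x k) \<le> ?c * 2"
      unfolding sums_unique[OF tail] sums_unique[OF geo]
      by (rule norm_suminf_le[OF _ sums_summable[OF geo]])
    then show ?thesis by (simp add: mult_ac)
  qed
  have "((\<lambda>t. t * (M * 2 ^ (k + 2))) \<longlongrightarrow> 0 * (M * 2 ^ (k + 2))) (at_right 0)"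
    by (intro tendsto_intros)
  moreover have "eventually (\<lambda>t. norm (x k) \<le> t * (M * 2 ^ (k + 2))) (at_right 0)"
    unfolding eventually_at_right_field using small by (intro exI[of _ "1/4"]) auto
  ultimately have "norm (x k) \<le> 0 * (M * 2 ^ (k + 2))"
    by (intro tendsto_lowerbound) auto
  then show "x k = 0" by simp
qed

lemma has_maclaurin_unique:
  assumes "has_maclaurin f x" "has_maclaurin f y"
  shows "x = y"
proof
  fix k
  have "(\<lambda>n. t ^ n *\<^sub>R (x n - y n)) sums 0" if t: "0 < t" "t < 1" for t :: real
  proof -
    have "complex_of_real t \<in> ball 0 1" using t by simp
    then have "(\<lambda>n. complex_of_real t ^ n *\<^sub>C x n - complex_of_real t ^ n *\<^sub>C y n) sums (f t - f t)"
      using assms unfolding has_maclaurin_def by (intro sums_diff) auto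
    then show ?thesis
      by (simp add: scaleR_diff_right scaleC_of_real flip: of_real_power)
  qed
  then have "x k - y k = 0"
    by (rule power_series_zero_imp_coeffs_zero)
  then show "x k = y k" by simp
qed

lemma maclaurin_eq: "has_maclaurin f x \<Longrightarrow> maclaurin f = x"
  unfolding maclaurin_def by (metis has_maclaurin_unique someI)

lemma one_scaleC: "1 *\<^sub>C x = (x::'x::complex_normed_vector)"
  using scaleC_of_real[of 1 x] by simp

lemma maclaurin_coeff_of_constant:
  assumes "has_maclaurin f x" "f constant_on \<Omega>" "ball 0 1 \<subseteq> \<Omega>" "1 \<le> n"
  shows "x n = 0"
proof -
  obtain c where "f z = c" if "z \<in> \<Omega>" for z
    using assms(2) unfolding constant_on_def by blast
  then have "f z = c" if "z \<in> ball 0 1" for z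
    using assms(3) that by blast
  moreover have "(\<lambda>n. z ^ n *\<^sub>C (if n = 0 then c else 0)) sums c" for z
    using sums_single[of 0 "\<lambda>_. c"] by (rule sums_cong[THEN iffD1, rotated]) (simp add: one_scaleC)
  ultimately have "has_maclaurin f (\<lambda>n. if n = 0 then c else 0)"
    unfolding has_maclaurin_def by simp
  with assms(1) have "x = (\<lambda>n. if n = 0 then c else 0)"
    by (rule has_maclaurin_unique)
  with assms(4) show ?thesis by simp
qed


section \<open>The modulus of a scalar operator\<close>

lemma cinner_diff_right: "cinner x (y - z) = cinner x y - cinner x (z::'h::chilbert)"
  using cinner_add_right[of x "y - z" z] by simp

lemma cinner_scaleC_left: "cinner (a *\<^sub>C x) y = cnj a * cinner x (y::'h::chilbert)"
  by (metis cinner_commute cinner_scaleC_right complex_cnj_mult)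

lemma scaleC_id_apply: "cblinfun_apply (a *\<^sub>C id_cblinfun) x = a *\<^sub>C x"
  by transfer simp

lemma scaleC_id_compose: "a *\<^sub>C id_cblinfun o\<^sub>C\<^sub>L b *\<^sub>C id_cblinfun = (a * b) *\<^sub>C id_cblinfun"
  by transfer (simp add: scaleC_scaleC)

lemma adj_eqI:
  fixes T :: "'a::chilbert \<Rightarrow>\<^sub>C\<^sub>L 'b::chilbert"
  assumes "\<And>x y. cinner (cblinfun_apply T x) y = cinner x (cblinfun_apply S y)"
  shows "adj T = S"
  unfolding adj_def
proof (rule the_equality)
  show "\<forall>x y. cinner (cblinfun_apply T x) y = cinner x (cblinfun_apply S y)"
    using assms by blast
next
  fix S' assume S': "\<forall>x y. cinner (cblinfun_apply T x) y = cinner x (cblinfun_apply S' y)"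
  have "cblinfun_apply S' y = cblinfun_apply S y" for y
  proof -
    let ?d = "cblinfun_apply S' y - cblinfun_apply S y"
    have "cinner ?d ?d = 0"
      using S' assms by (metis cinner_diff_right diff_self)
    then show ?thesis by (simp add: cinner_self)
  qed
  then show "S' = S"
    by (simp add: cblinfun_apply_inject[symmetric] fun_eq_iff)
qed

lemma adj_scaleC_id: "adj (a *\<^sub>C id_cblinfun :: 'h::chilbert \<Rightarrow>\<^sub>C\<^sub>L 'h) = cnj a *\<^sub>C id_cblinfun"
  by (rule adj_eqI) (simp add: scaleC_id_apply cinner_scaleC_left cinner_scaleC_right)

text \<open>The operator \<open>|a| I\<close> is a positive square root of \<open>(a I)\<^sup>* (a I)\<close>. Whichever root is chosen
  as modulus, its square is therefore \<open>|a|\<^sup>2 I\<close>.\<close>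

lemma abs_op_scaleC_id_squared:
  fixes a :: complex
  defines "T \<equiv> (a *\<^sub>C id_cblinfun :: 'h::chilbert \<Rightarrow>\<^sub>C\<^sub>L 'h)"
  shows "abs_op T o\<^sub>C\<^sub>L abs_op T = complex_of_real ((cmod a)\<^sup>2) *\<^sub>C id_cblinfun"
proof -
  let ?S = "complex_of_real (cmod a) *\<^sub>C id_cblinfun :: 'h \<Rightarrow>\<^sub>C\<^sub>L 'h"
  have adj: "adj T o\<^sub>C\<^sub>L T = complex_of_real ((cmod a)\<^sup>2) *\<^sub>C id_cblinfun"
    unfolding T_def adj_scaleC_id scaleC_id_compose complex_norm_square by (simp add: mult.commute)
  have "positive_op ?S"
    unfolding positive_op_def
    by (simp add: scaleC_id_apply cinner_scaleC_right cinner_self flip: of_real_mult of_real_power)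
  moreover have "?S o\<^sub>C\<^sub>L ?S = adj T o\<^sub>C\<^sub>L T"
    unfolding adj by (simp add: scaleC_id_compose power2_eq_square)
  ultimately have "positive_op ?S \<and> ?S o\<^sub>C\<^sub>L ?S = adj T o\<^sub>C\<^sub>L T"
    by blast
  then have "abs_op T o\<^sub>C\<^sub>L abs_op T = adj T o\<^sub>C\<^sub>L T"
    unfolding abs_op_def by (rule someI2) blast
  with adj show ?thesis by simp
qed

lemma norm_id_cblinfun_le: "norm (id_cblinfun :: 'h::complex_normed_vector \<Rightarrow>\<^sub>C\<^sub>L 'h) \<le> 1"
  by transfer (rule onorm_id_le)

lemma id_minus_abs_op_scaleC_id_squared:
  fixes a :: complex
  defines "T \<equiv> (a *\<^sub>C id_cblinfun :: 'h::chilbert \<Rightarrow>\<^sub>C\<^sub>L 'h)"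
  shows "id_cblinfun - abs_op T o\<^sub>C\<^sub>L abs_op T
    = complex_of_real (1 - (cmod a)\<^sup>2) *\<^sub>C id_cblinfun"
  unfolding T_def abs_op_scaleC_id_squared scaleC_of_real
  by (simp add: scaleR_diff_left)

text \<open>This disposes of the zero space, where the quotients in \<^const>\<open>lambda_H\<close> read \<open>0 / 0\<close>.\<close>

lemma cblinfun_eq_zero_if_id_zero:
  fixes T :: "'h::complex_normed_vector \<Rightarrow>\<^sub>C\<^sub>L 'h"
  assumes "(id_cblinfun :: 'h \<Rightarrow>\<^sub>C\<^sub>L 'h) = 0"
  shows "T = 0"
proof -
  have zero: "x = 0" for x :: 'h
    using arg_cong[OF assms, of "\<lambda>S. cblinfun_apply S x"]
    by (simp add: id_cblinfun.rep_eq zero_cblinfun.rep_eq)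
  have "cblinfun_apply T x = cblinfun_apply 0 x" for x
    using zero[of "cblinfun_apply T x"] zero[of "cblinfun_apply 0 x"] by simp
  then show ?thesis
    by (simp add: cblinfun_apply_inject[symmetric] fun_eq_iff)
qed


section \<open>The coefficient estimate\<close>

lemma norm_le_one_if_Hinf_norm_le_one:
  assumes "f \<in> Hinf \<Omega>" "Hinf_norm \<Omega> f \<le> 1" "z \<in> \<Omega>"
  shows "norm (f z) \<le> 1"
proof -
  have "bdd_above ((\<lambda>z. norm (f z)) ` \<Omega>)"
    using assms(1) unfolding Hinf_def bounded_iff bdd_above_def by fastforce
  then have "norm (f z) \<le> Hinf_norm \<Omega> f"
    unfolding Hinf_norm_def using assms(3) by (rule cSUP_upper[rotated])
  with assms(2) show ?thesis by simp
qed

text \<open>The supremum bounds \<open>\<parallel>A\<^sub>n\<parallel>\<close> by \<open>\<lambda> \<parallel>I - |A\<^sub>0|\<^sup>2\<parallel>\<close>, and \<open>I - |A\<^sub>0|\<^sup>2\<close> is a positive multiple of the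
  identity. The functions outside the supremum are the constant ones, whose higher coefficients
  vanish.\<close>

lemma norm_coeff_le_lambda_H:
  fixes f :: "complex \<Rightarrow> ('h::chilbert \<Rightarrow>\<^sub>C\<^sub>L 'h)"
  assumes f: "f \<in> Hinf \<Omega>" "Hinf_norm \<Omega> f \<le> 1" "has_maclaurin f A" "ball 0 1 \<subseteq> \<Omega>"
    and A0: "A 0 = \<alpha> *\<^sub>C id_cblinfun" "cmod \<alpha> < 1"
    and n: "1 \<le> n"
  shows "ennreal (norm (A n)) \<le> lambda_H TYPE('h) \<Omega> * ennreal (1 - (cmod \<alpha>)\<^sup>2)"
proof (cases "f constant_on \<Omega> \<or> (id_cblinfun :: 'h \<Rightarrow>\<^sub>C\<^sub>L 'h) = 0")
  case True
  then have "A n = 0"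
    using maclaurin_coeff_of_constant[OF f(3) _ f(4) n] cblinfun_eq_zero_if_id_zero by blast
  then show ?thesis by simp
next
  case False
  let ?D = "norm (id_cblinfun - abs_op (A 0) o\<^sub>C\<^sub>L abs_op (A 0))"
  have pos: "0 < 1 - (cmod \<alpha>)\<^sup>2"
    using A0(2) by (simp add: abs_square_less_1)
  have D: "?D = (1 - (cmod \<alpha>)\<^sup>2) * norm (id_cblinfun :: 'h \<Rightarrow>\<^sub>C\<^sub>L 'h)"
    unfolding A0(1) id_minus_abs_op_scaleC_id_squared norm_scaleC norm_of_real using pos by simp
  have D_pos: "0 < ?D"
    unfolding D using pos False by simp
  have D_le: "?D \<le> 1 - (cmod \<alpha>)\<^sup>2"
    unfolding D using pos norm_id_cblinfun_le[where 'h='h] by (simp add: mult_left_le)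
  have "ennreal (norm (A n) / ?D) \<le> lambda_H TYPE('h) \<Omega>"
    unfolding lambda_H_def
    using False f n norm_le_one_if_Hinf_norm_le_one[OF f(1,2)] by (intro Sup_upper) blast
  then have "ennreal (norm (A n) / ?D) * ennreal ?D
      \<le> lambda_H TYPE('h) \<Omega> * ennreal (1 - (cmod \<alpha>)\<^sup>2)"
    using D_le by (intro mult_mono) (auto intro: ennreal_leI)
  then show ?thesis
    using D_pos by (simp flip: ennreal_mult')
qed


section \<open>The Bohr inequality\<close>

text \<open>Concavity of \<open>s \<mapsto> s\<^bsup>p/2\<^esup>\<close> at \<open>s = 1\<close>, in the form of Young's inequality for \<open>a\<^sup>2\<close> and \<open>1\<close>.\<close>

lemma powr_le_affine_in_square:
  fixes a p :: real
  assumes "0 \<le> a" "0 < p" "p \<le> 2"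
  shows "a powr p \<le> 1 - p / 2 * (1 - a\<^sup>2)"
proof (cases "a = 0")
  case True
  then show ?thesis using assms by simp
next
  case False
  have "a powr p = (a powr 2) powr (p / 2) * 1 powr (1 - p / 2)"
    by (simp add: powr_powr)
  also have "\<dots> = (a\<^sup>2) powr (p / 2) * 1 powr (1 - p / 2)"
    using assms False by simp
  also have "\<dots> \<le> p / 2 * a\<^sup>2 + (1 - p / 2) * 1"
    using assms False by (intro Youngs_inequality_0) auto
  finally show ?thesis by (simp add: algebra_simps)
qed

lemma class_G_summable:
  assumes "\<phi> \<in> class_G" "r \<in> {0..<1}"
  shows "summable (\<lambda>n. \<phi> n r)"
proof -
  obtain e where "e > 0"
    and "uniformly_convergent_on ({0..<1} \<inter> ball r e) (\<lambda>N s. \<Sum>n<N. \<phi> n s)"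
    using assms unfolding class_G_def by blast
  then have "convergent (\<lambda>N. \<Sum>n<N. \<phi> n r)"
    using assms(2) by (intro uniformly_convergent_imp_convergent[where x=r]) auto
  then show ?thesis by (simp add: summable_iff_convergent)
qed

text \<open>Below the first root \<open>bound\<close> is strict, and at the root it is an equality; the argument
  covers both. In \<^typ>\<open>ennreal\<close> the product \<open>\<infinity> \<cdot> 0\<close> is \<open>0\<close>, so for \<open>\<lambda> = \<infinity>\<close> the hypothesis says that
  \<open>\<Sum> \<phi>\<^sub>n(r)\<close> vanishes, and so does the series of the \<open>\<parallel>A\<^sub>n\<parallel> \<phi>\<^sub>n(r)\<close>.\<close>

lemma bohr_inequality_at:
  fixes f :: "complex \<Rightarrow> ('h::chilbert \<Rightarrow>\<^sub>C\<^sub>L 'h)"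
  assumes f: "f \<in> Hinf \<Omega>" "Hinf_norm \<Omega> f \<le> 1" "has_maclaurin f A" "ball 0 1 \<subseteq> \<Omega>"
    and A0: "A 0 = \<alpha> *\<^sub>C id_cblinfun" "cmod \<alpha> < 1"
    and p: "1 \<le> p" "p \<le> 2"
    and \<phi>: "\<phi> \<in> class_G" and r: "r \<in> {0..<1}"
    and bound: "2 * lambda_H TYPE('h) \<Omega> * ennreal (\<Sum>n. \<phi> (Suc n) r) \<le> ennreal (p * \<phi> 0 r)"
  shows "summable (\<lambda>n. norm (A (Suc n)) * \<phi> (Suc n) r) \<and>
    norm (A 0) powr p * \<phi> 0 r + (\<Sum>n. norm (A (Suc n)) * \<phi> (Suc n) r) \<le> \<phi> 0 r"
proof -
  let ?L = "lambda_H TYPE('h) \<Omega>" and ?d = "1 - (cmod \<alpha>)\<^sup>2"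
  let ?t = "\<lambda>n. norm (A (Suc n)) * \<phi> (Suc n) r"
  have nonneg: "0 \<le> \<phi> n r" for n
    using \<phi> r unfolding class_G_def by blast
  have d: "0 \<le> ?d"
    using A0(2) by (simp add: abs_square_le_1)
  have sum_\<phi>: "summable (\<lambda>n. \<phi> (Suc n) r)"
    using class_G_summable[OF \<phi> r] by (subst summable_Suc_iff)
  have "2 * (\<Sum>n. ennreal (?t n)) \<le> 2 * (\<Sum>n. (?L * ennreal ?d) * ennreal (\<phi> (Suc n) r))"
    using norm_coeff_le_lambda_H[OF f A0] nonneg
    by (intro mult_left_mono suminf_le) (auto simp: ennreal_mult' intro!: mult_right_mono)
  also have "\<dots> = ennreal ?d * (2 * ?L * ennreal (\<Sum>n. \<phi> (Suc n) r))"
    using sum_\<phi> nonneg by (simp add: suminf_ennreal2 mult_ac)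
  also have "\<dots> \<le> ennreal ?d * ennreal (p * \<phi> 0 r)"
    using bound by (rule mult_left_mono) simp
  also have "\<dots> = 2 * ennreal (p / 2 * ?d * \<phi> 0 r)"
    using d p nonneg by (simp flip: ennreal_mult' ennreal_numeral)
  finally have le: "(\<Sum>n. ennreal (?t n)) \<le> ennreal (p / 2 * ?d * \<phi> 0 r)"
    by (subst (asm) ennreal_mult_le_mult_iff) auto
  have sum_t: "summable ?t"
    using le nonneg by (intro summable_suminf_not_top) (auto simp: top_unique)
  have "ennreal (\<Sum>n. ?t n) \<le> ennreal (p / 2 * ?d * \<phi> 0 r)"
    using le sum_t nonneg by (simp add: suminf_ennreal2)
  then have sum_le: "(\<Sum>n. ?t n) \<le> p / 2 * ?d * \<phi> 0 r"
    using d p nonneg by (subst (asm) ennreal_le_iff) auto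
  have "norm (A 0) \<le> cmod \<alpha>"
    unfolding A0(1) norm_scaleC using norm_id_cblinfun_le[where 'h='h] by (simp add: mult_left_le)
  then have "norm (A 0) powr p \<le> cmod \<alpha> powr p"
    using p by (intro powr_mono2) auto
  also have "\<dots> \<le> 1 - p / 2 * ?d"
    using p by (intro powr_le_affine_in_square) auto
  finally have "norm (A 0) powr p * \<phi> 0 r \<le> (1 - p / 2 * ?d) * \<phi> 0 r"
    using nonneg by (rule mult_right_mono)
  with sum_le sum_t show ?thesis by (simp add: algebra_simps)
qed

theorem theorem1p3:
  fixes \<Omega> :: "complex set"
    and f :: "complex \<Rightarrow> ('h::chilbert \<Rightarrow>\<^sub>C\<^sub>L 'h)"
    and A :: "nat \<Rightarrow> ('h \<Rightarrow>\<^sub>C\<^sub>L 'h)"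
    and \<alpha>\<^sub>0 :: complex
    and p R :: real
    and \<phi> :: "nat \<Rightarrow> real \<Rightarrow> real"
  assumes "open \<Omega>" and "connected \<Omega>" and "simply_connected \<Omega>"
    and "\<Omega> \<noteq> UNIV" and "ball 0 1 \<subseteq> \<Omega>"
    and "1 \<le> p" and "p \<le> 2"
    and "f \<in> Hinf \<Omega>" and "Hinf_norm \<Omega> f \<le> 1"
    and "has_maclaurin f A"
    and "A 0 = \<alpha>\<^sub>0 *\<^sub>C id_cblinfun" and "cmod \<alpha>\<^sub>0 < 1"
    and "\<phi> \<in> class_G"
    and R_root: "0 < R" "R < 1"
      "ennreal (p * \<phi> 0 R) = 2 * lambda_H TYPE('h) \<Omega> * ennreal (\<Sum>n. \<phi> (Suc n) R)"
    and R_smallest: "\<forall>r\<in>{0<..<1}.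
      ennreal (p * \<phi> 0 r) = 2 * lambda_H TYPE('h) \<Omega> * ennreal (\<Sum>n. \<phi> (Suc n) r) \<longrightarrow> R \<le> r"
    and "\<forall>r\<in>{0..<R}.
      ennreal (p * \<phi> 0 r) > 2 * lambda_H TYPE('h) \<Omega> * ennreal (\<Sum>n. \<phi> (Suc n) r)"
  shows "(\<forall>r\<in>{0..R}.
            summable (\<lambda>n. norm (A (Suc n)) * \<phi> (Suc n) r) \<and>
            norm (A 0) powr p * \<phi> 0 r + (\<Sum>n. norm (A (Suc n)) * \<phi> (Suc n) r) \<le> \<phi> 0 r) \<and>
         ((\<forall>r\<in>{0..<1}. \<phi> 0 r \<le> 1) \<longrightarrow>
            ennreal R \<le> bohr_radius p 1 \<phi>
              (scalar_unit_ball \<Omega> :: (complex \<Rightarrow> ('h \<Rightarrow>\<^sub>C\<^sub>L 'h)) set))"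
proof -
  have bound: "2 * lambda_H TYPE('h) \<Omega> * ennreal (\<Sum>n. \<phi> (Suc n) r) \<le> ennreal (p * \<phi> 0 r)"
    if "r \<in> {0..R}" for r
  proof (cases "r = R")
    case True
    then show ?thesis using R_root(3) by simp
  next
    case False
    then have "r \<in> {0..<R}" using that by simp
    then show ?thesis using assms(18) by (simp add: less_imp_le)
  qed
  have "ennreal R \<le> bohr_radius_fun p 1 \<phi> g" if "g \<in> scalar_unit_ball \<Omega>"
    for g :: "complex \<Rightarrow> ('h \<Rightarrow>\<^sub>C\<^sub>L 'h)"
  proof -
    obtain B \<beta> where g: "g \<in> Hinf \<Omega>" "Hinf_norm \<Omega> g \<le> 1" "has_maclaurin g B"
      and B0: "B 0 = \<beta> *\<^sub>C id_cblinfun" "cmod \<beta> < 1"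
      using \<open>g \<in> scalar_unit_ball \<Omega>\<close> unfolding scalar_unit_ball_def Hinf_ball_def by blast
    have "summable (\<lambda>n. norm (B (Suc n)) * \<phi> (Suc n) R) \<and>
        norm (B 0) powr p * \<phi> 0 R + (\<Sum>n. norm (B (Suc n)) * \<phi> (Suc n) R) \<le> \<phi> 0 R"
      using bound R_root(1,2) assms(5,6,7,13) g B0 by (intro bohr_inequality_at) auto
    moreover have "0 \<le> (\<Sum>n. norm (B (Suc n)) * \<phi> (Suc n) R)"
      using \<open>\<phi> \<in> class_G\<close> R_root(1,2) calculation unfolding class_G_def
      by (intro suminf_nonneg) auto
    ultimately have "bohr_ineq p 1 \<phi> (maclaurin g) R"
      unfolding maclaurin_eq[OF g(3)] bohr_ineq_def by simp
    then show ?thesis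
      unfolding bohr_radius_fun_def using R_root(1,2) by (intro SUP_upper) auto
  qed
  then have radius: "ennreal R \<le> bohr_radius p 1 \<phi>
      (scalar_unit_ball \<Omega> :: (complex \<Rightarrow> ('h \<Rightarrow>\<^sub>C\<^sub>L 'h)) set)"
    unfolding bohr_radius_def by (rule INF_greatest)
  have "summable (\<lambda>n. norm (A (Suc n)) * \<phi> (Suc n) r) \<and>
      norm (A 0) powr p * \<phi> 0 r + (\<Sum>n. norm (A (Suc n)) * \<phi> (Suc n) r) \<le> \<phi> 0 r"
    if "r \<in> {0..R}" for r
    using bound[OF that] that R_root(2) assms(5-13) by (intro bohr_inequality_at) auto
  with radius show ?thesis by simp
qed

end
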